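(* Let $\alpha\in[g,G]$. Every irrational number $x\in I_\alpha=[\alpha-2,\alpha)$ can be uniquely represented as $$x=\cfrac{e_1}{d_1+\cfrac{e_2}{d_2+\cfrac{e_3}{d_3+\cdots}}},$$ where the digits $e_i=e_i(x;\alpha)\in\{\pm1\}$ and $d_i=d_i(x;\alpha)\in 2\mathbb N-1$ (positive odd integers) are determined by the iterates of $\varphi_\alpha$, namely $e_i=\operatorname{sign}(\varphi_\alpha^{i-1}(x))$ and $d_i=d_\alpha(\varphi_\alpha^{i-1}(x))$ for all $i\ge 1$.
   Context: $g=\frac12(\sqrt5-1)$, $G=\frac12(\sqrt5+1)$, and $[\cdot]$ denotes the integer part (floor). For $\alpha\in[g,G]$ put $I_\alpha=[\alpha-2,\alpha)$ and, for $x\neq0$, $d_\alpha(x)=2\left[\frac1{2|x|}+\frac{1-\alpha}2\right]+1$. The map $\varphi_\alpha:I_\alpha\to I_\alpha$ is defined by $\varphi_\alpha(0)=0$ and $\varphi_\alpha(x)=\frac1{|x|}-d_\alpha(x)$ for $x\in I_\alpha\setminus\{0\}$; $\varphi_\alpha^{k}$ is its $k$-th iterate. If $x$ is irrational then all $\varphi_\alpha^{k}(x)$ are irrational, hence nonzero. The value of the infinite continued fraction is the limit, as $n\to\infty$, of its finite truncations $\cfrac{e_1}{d_1+\cfrac{e_2}{d_2+\cdots+\cfrac{e_n}{d_n}}}$. *)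

theory Defs
  imports Complex_Main
begin

definition small_golden :: real where
  "small_golden = (sqrt 5 - 1) / 2"

definition big_golden :: real where
  "big_golden = (sqrt 5 + 1) / 2"

definition I_alpha :: "real \<Rightarrow> real set" where
  "I_alpha \<alpha> = {\<alpha> - 2..<\<alpha>}"

definition d_alpha :: "real \<Rightarrow> real \<Rightarrow> int" where
  "d_alpha \<alpha> x = 2 * \<lfloor>1 / (2 * \<bar>x\<bar>) + (1 - \<alpha>) / 2\<rfloor> + 1"

definition phi_alpha :: "real \<Rightarrow> real \<Rightarrow> real" where
  "phi_alpha \<alpha> x = (if x = 0 then 0 else 1 / \<bar>x\<bar> - of_int (d_alpha \<alpha> x))"

(* Digit sequences are indexed from 0: the value at i is the digit usually numbered i + 1.
   cf_trunc e d n is the truncation after n levels, e 0 / (d 0 + e 1 / (d 1 + ... )). *)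
fun cf_trunc :: "(nat \<Rightarrow> int) \<Rightarrow> (nat \<Rightarrow> int) \<Rightarrow> nat \<Rightarrow> real" where
  "cf_trunc e d 0 = 0"
| "cf_trunc e d (Suc n) =
     of_int (e 0) / (of_int (d 0) + cf_trunc (\<lambda>i. e (Suc i)) (\<lambda>i. d (Suc i)) n)"

(* No denominator occurring in cf_trunc e d n vanishes, so its value does not
   depend on the convention a / 0 = 0. *)
fun cf_trunc_defined :: "(nat \<Rightarrow> int) \<Rightarrow> (nat \<Rightarrow> int) \<Rightarrow> nat \<Rightarrow> bool" where
  "cf_trunc_defined e d 0 \<longleftrightarrow> True"
| "cf_trunc_defined e d (Suc n) \<longleftrightarrow>
     cf_trunc_defined (\<lambda>i. e (Suc i)) (\<lambda>i. d (Suc i)) n \<and>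
     of_int (d 0) + cf_trunc (\<lambda>i. e (Suc i)) (\<lambda>i. d (Suc i)) n \<noteq> 0"

definition has_cf_value :: "(nat \<Rightarrow> int) \<Rightarrow> (nat \<Rightarrow> int) \<Rightarrow> real \<Rightarrow> bool" where
  "has_cf_value e d x \<longleftrightarrow> (\<forall>n. cf_trunc_defined e d n) \<and> cf_trunc e d \<longlonglongrightarrow> x"

definition odd_cf_representation :: "(nat \<Rightarrow> int) \<Rightarrow> (nat \<Rightarrow> int) \<Rightarrow> real \<Rightarrow> bool" where
  "odd_cf_representation e d x \<longleftrightarrow>
     (\<forall>i. e i \<in> {1, -1} \<and> odd (d i) \<and> d i > 0) \<and> has_cf_value e d x"

(* An irrational number has many odd continued fractions (for instance, different
   parameters alpha usually give different ones), so uniqueness only makes sense within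
   the alpha-expansions: those in which every tail has its value in I_alpha. *)
definition alpha_representation ::
    "real \<Rightarrow> (nat \<Rightarrow> int) \<Rightarrow> (nat \<Rightarrow> int) \<Rightarrow> real \<Rightarrow> bool" where
  "alpha_representation \<alpha> e d x \<longleftrightarrow>
     odd_cf_representation e d x \<and>
     (\<forall>k. \<exists>y\<in>I_alpha \<alpha>. has_cf_value (\<lambda>i. e (i + k)) (\<lambda>i. d (i + k)) y)"

end

theory Submission
  imports Defs
begin

text \<open>
  Let \<open>y\<^sub>n\<close> be the orbit of \<open>x\<close> and \<open>B n\<close>, \<open>B (n + 1)\<close> consecutive continuant denominators.
  Convergence rests on an invariant region for the pair formed by \<open>y\<^sub>n\<close> and \<open>B n / B (n + 1)\<close>:
  the ratio lies in \<open>[0, G]\<close>, and in \<open>[0, g\<^sup>2]\<close> whenever \<open>y\<^sub>n < - g\<^sup>2\<close>. The number \<open>g\<^sup>2\<close> occurs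
  because it is fixed by \<open>c \<mapsto> 1 / (3 - c)\<close>, the branch belonging to the digits \<open>e = - 1\<close>, \<open>d = 3\<close>.
  In this region all denominators are positive and grow geometrically, and
  \<open>B (n + 1) + y\<^sub>n * B n\<close> is at least a fixed multiple of \<open>B (n + 1)\<close>, so that the error of the
  \<open>n\<close>-th truncation is \<open>O(1 / B (n + 1)\<^sup>2)\<close>.
  For uniqueness, passing to the limit gives \<open>y\<^sub>k * (d\<^sub>k + y\<^sub>k\<^sub>+\<^sub>1) = e\<^sub>k\<close> for the values of the
  tails, and since these lie in \<open>I\<^sub>\<alpha>\<close> this forces the digits to be those of \<open>\<phi>\<^sub>\<alpha>\<close>.
\<close>

subsection \<open>Continuants\<close>

text \<open>Indices are shifted by one: the \<open>n\<close>-th truncation is \<open>cnum e d (n + 1) / cden e d (n + 1)\<close>.\<close>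

fun cnum :: "(nat \<Rightarrow> int) \<Rightarrow> (nat \<Rightarrow> int) \<Rightarrow> nat \<Rightarrow> real" where
  "cnum e d 0 = 1"
| "cnum e d (Suc 0) = 0"
| "cnum e d (Suc (Suc n)) = of_int (d n) * cnum e d (Suc n) + of_int (e n) * cnum e d n"

fun cden :: "(nat \<Rightarrow> int) \<Rightarrow> (nat \<Rightarrow> int) \<Rightarrow> nat \<Rightarrow> real" where
  "cden e d 0 = 0"
| "cden e d (Suc 0) = 1"
| "cden e d (Suc (Suc n)) = of_int (d n) * cden e d (Suc n) + of_int (e n) * cden e d n"

text \<open>Truncations split off the first digit, the continuant recursion the last one;
  \<open>cnum_Suc\<close> and \<open>cden_Suc\<close> convert between the two.\<close>

lemma cnum_Suc:
  "cnum e d (Suc n) = of_int (e 0) * cden (\<lambda>i. e (Suc i)) (\<lambda>i. d (Suc i)) n"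
  by (induction n rule: cden.induct[of _ e d, case_names 0 1 step])
    (simp_all add: algebra_simps)

lemma cden_Suc:
  "cden e d (Suc n) = of_int (d 0) * cden (\<lambda>i. e (Suc i)) (\<lambda>i. d (Suc i)) n
     + cnum (\<lambda>i. e (Suc i)) (\<lambda>i. d (Suc i)) n"
  by (induction n rule: cden.induct[of _ e d, case_names 0 1 step])
    (simp_all add: algebra_simps)

text \<open>The denominators met inside \<open>cf_trunc\<close> are quotients of continuants of a
  sequence and of its tail, so nonvanishing is demanded for all shifts \<open>k\<close>.\<close>

lemma cf_trunc_eq_continuants:
  assumes "\<And>k n. cden (\<lambda>i. e (i + k)) (\<lambda>i. d (i + k)) (Suc n) \<noteq> 0"
  shows "cf_trunc_defined e d n \<and> cf_trunc e d n = cnum e d (Suc n) / cden e d (Suc n)"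
  using assms
proof (induction n arbitrary: e d)
  case 0
  then show ?case by simp
next
  case (Suc n)
  let ?e = "\<lambda>i. e (Suc i)" and ?d = "\<lambda>i. d (Suc i)"
  have nz: "cden (\<lambda>i. ?e (i + k)) (\<lambda>i. ?d (i + k)) (Suc m) \<noteq> 0" for k m
    using Suc.prems[of "Suc k" m] by simp
  note IH = Suc.IH[of ?e ?d, OF nz]
  have nz1: "cden ?e ?d (Suc n) \<noteq> 0"
    using nz[of 0 n] by simp
  have nz2: "cden e d (Suc (Suc n)) \<noteq> 0"
    using Suc.prems[of 0 "Suc n"] by simp
  have den: "of_int (d 0) + cf_trunc ?e ?d n = cden e d (Suc (Suc n)) / cden ?e ?d (Suc n)"
    unfolding cden_Suc[of e d "Suc n"] conjunct2[OF IH] using nz1 by (simp add: field_simps)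
  then show ?case
    using IH nz1 nz2 unfolding cnum_Suc[of e d "Suc n"]
    by (simp del: cden.simps cnum.simps add: den)
qed

text \<open>Each step matrix has determinant \<open>- e n\<close>, which is 1 or -1.\<close>

lemma continuant_det:
  assumes "\<And>i. e i \<in> {1, -1}"
  shows "\<bar>cnum e d n * cden e d (Suc n) - cnum e d (Suc n) * cden e d n\<bar> = 1"
proof (induction n)
  case 0
  then show ?case by simp
next
  case (Suc n)
  have "cnum e d (Suc n) * cden e d (Suc (Suc n)) - cnum e d (Suc (Suc n)) * cden e d (Suc n)
      = - of_int (e n) * (cnum e d n * cden e d (Suc n) - cnum e d (Suc n) * cden e d n)"
    by (simp add: algebra_simps)
  moreover have "\<bar>real_of_int (e n)\<bar> = 1"
    using assms[of n] by auto
  ultimately show ?case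
    using Suc by (simp only: abs_mult abs_minus_cancel mult_1_left)
qed

subsection \<open>The golden numbers and the map\<close>

lemma small_golden_sq: "small_golden * small_golden = 1 - small_golden"
  by (simp add: small_golden_def field_simps)

lemma big_golden_eq: "big_golden = 1 + small_golden"
  by (simp add: small_golden_def big_golden_def field_simps)

lemma small_golden_bounds: "0.618 < small_golden" "small_golden < 0.619"
proof -
  have "2.236 < sqrt 5" "sqrt 5 < 2.238"
    by (rule real_less_rsqrt, simp add: power2_eq_square)
      (rule real_less_lsqrt, simp_all add: power2_eq_square)
  then show "0.618 < small_golden" "small_golden < 0.619"
    by (simp_all add: small_golden_def)
qed

text \<open>\<open>phi_alpha \<alpha> x\<close> is \<alpha> - 2 plus twice a fractional
  part.\<close>

lemma phi_alpha_in_I_alpha: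
  assumes "x \<noteq> 0"
  shows "phi_alpha \<alpha> x \<in> I_alpha \<alpha>"
proof -
  define u where "u = 1 / (2 * \<bar>x\<bar>) + (1 - \<alpha>) / 2"
  have "1 / \<bar>x\<bar> = 2 * u - (1 - \<alpha>)"
    by (simp add: u_def field_simps)
  then have "phi_alpha \<alpha> x = 2 * u - 2 * of_int \<lfloor>u\<rfloor> - 2 + \<alpha>"
    using assms by (simp add: phi_alpha_def d_alpha_def u_def)
  then show ?thesis
    using floor_correct[of u] unfolding I_alpha_def atLeastLessThan_iff of_int_add of_int_1
    by linarith
qed

text \<open>The translates of \<open>I_alpha \<alpha>\<close> by odd integers tile the line, as its
  length is 2.\<close>

lemma d_alpha_unique:
  assumes "odd d" and "1 / \<bar>x\<bar> = of_int d + z" and "z \<in> I_alpha \<alpha>"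
  shows "d_alpha \<alpha> x = d"
proof -
  obtain m where m: "d = 2 * m + 1" using assms(1) by (elim oddE)
  define u where "u = 1 / (2 * \<bar>x\<bar>) + (1 - \<alpha>) / 2"
  have "1 / \<bar>x\<bar> = 2 * u - (1 - \<alpha>)"
    by (simp add: u_def field_simps)
  then have "\<lfloor>u\<rfloor> = m"
    using assms(2,3) m by (intro floor_unique) (auto simp: I_alpha_def)
  then show ?thesis by (simp add: d_alpha_def u_def m)
qed

lemma abs_le_big_golden:
  assumes "\<alpha> \<in> {small_golden..big_golden}" and "x \<in> I_alpha \<alpha>"
  shows "\<bar>x\<bar> \<le> big_golden"
  using assms small_golden_bounds by (auto simp: I_alpha_def big_golden_eq)

text \<open>Since gG = 1, 1/|x| is at least g = G - 1, hence at least \<alpha> - 1, and the floor is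
  nonnegative.\<close>

lemma d_alpha_pos:
  assumes \<alpha>: "\<alpha> \<in> {small_golden..big_golden}" and x: "x \<in> I_alpha \<alpha>" "x \<noteq> 0"
  shows "0 < d_alpha \<alpha> x"
proof -
  have "small_golden * \<bar>x\<bar> \<le> small_golden * big_golden"
    using abs_le_big_golden[OF \<alpha> x(1)] small_golden_bounds by (intro mult_left_mono) auto
  also have "\<dots> = 1"
    using small_golden_sq by (simp add: big_golden_eq algebra_simps)
  finally have "small_golden \<le> 1 / \<bar>x\<bar>"
    using x(2) by (simp add: field_simps)
  then have "\<alpha> - 1 \<le> 1 / \<bar>x\<bar>"
    using \<alpha> by (auto simp: big_golden_eq)
  moreover have "1 / (2 * \<bar>x\<bar>) = (1 / \<bar>x\<bar>) / 2" by simp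
  ultimately have "0 \<le> 1 / (2 * \<bar>x\<bar>) + (1 - \<alpha>) / 2"
    by (simp only:) (simp add: field_simps)
  then show ?thesis by (simp add: d_alpha_def)
qed

lemma phi_alpha_iterate_irrational:
  assumes "x \<notin> \<rat>"
  shows "(phi_alpha \<alpha> ^^ k) x \<notin> \<rat>"
proof (induction k)
  case 0
  then show ?case using assms by simp
next
  case (Suc k)
  define y where "y = (phi_alpha \<alpha> ^^ k) x"
  have y: "y \<notin> \<rat>" "y \<noteq> 0" using Suc by (auto simp: y_def)
  have eq: "\<bar>y\<bar> = inverse (phi_alpha \<alpha> y + of_int (d_alpha \<alpha> y))"
    using y by (simp add: phi_alpha_def)
  have "phi_alpha \<alpha> y \<notin> \<rat>"
  proof
    assume "phi_alpha \<alpha> y \<in> \<rat>"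
    then have "\<bar>y\<bar> \<in> \<rat>" unfolding eq by simp
    then show False using y(1) by (auto simp: abs_if split: if_splits)
  qed
  then show ?case by (simp add: y_def)
qed

lemma phi_alpha_iterate_in_I_alpha:
  assumes "x \<in> I_alpha \<alpha>" and "x \<notin> \<rat>"
  shows "(phi_alpha \<alpha> ^^ k) x \<in> I_alpha \<alpha>"
proof (cases k)
  case 0
  then show ?thesis using assms(1) by simp
next
  case (Suc m)
  have "(phi_alpha \<alpha> ^^ m) x \<noteq> 0"
    using phi_alpha_iterate_irrational[OF assms(2), of m \<alpha>] by auto
  then show ?thesis using Suc phi_alpha_in_I_alpha by simp
qed

subsection \<open>Convergence\<close>

text \<open>The assumptions survive shifts of the index, so every result holds for all tails, as the
  definedness of the truncations requires.\<close>

locale odd_expansion =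
  fixes \<alpha> :: real and y :: "nat \<Rightarrow> real" and e d :: "nat \<Rightarrow> int"
  assumes alpha: "\<alpha> \<in> {small_golden..big_golden}"
    and orbit: "y n \<in> I_alpha \<alpha>"
    and nonzero: "y n \<noteq> 0"
    and e_sgn: "of_int (e n) = sgn (y n)"
    and d_odd: "odd (d n)" and d_pos: "0 < d n"
    and step: "1 / \<bar>y n\<bar> = of_int (d n) + y (Suc n)"
begin

lemma e_cases: "e n = 1 \<and> 0 < y n \<or> e n = -1 \<and> y n < 0"
  using e_sgn[of n] nonzero[of n] by (auto simp: sgn_if split: if_splits)

lemma tail: "odd_expansion \<alpha> (\<lambda>i. y (i + k)) (\<lambda>i. e (i + k)) (\<lambda>i. d (i + k))"
  by unfold_locales (use alpha orbit nonzero e_sgn d_odd d_pos step in auto)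

lemma step': "\<bar>y n\<bar> * (of_int (d n) + y (Suc n)) = 1"
  using step[of n] nonzero[of n] by (simp add: field_simps)

lemma abs_y_le: "\<bar>y n\<bar> \<le> 1 + small_golden"
  using abs_le_big_golden[OF alpha orbit] by (simp add: big_golden_eq)

lemma y_lower: "small_golden - 2 \<le> y n"
  using alpha orbit[of n] by (auto simp: I_alpha_def)

lemma y_upper: "y n < 1 + small_golden"
  using alpha orbit[of n] by (auto simp: I_alpha_def big_golden_eq)

text \<open>The threshold \<open>1 - small_golden\<close> is \<open>g\<^sup>2\<close>.\<close>

lemma y_below_threshold:
  assumes "e n = -1" and "of_int (d n) + y (Suc n) < 2 + small_golden"
  shows "y n < small_golden - 1"
proof (rule ccontr)
  assume "\<not> y n < small_golden - 1"
  then have le: "\<bar>y n\<bar> \<le> 1 - small_golden"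
    using assms(1) e_cases[of n] by auto
  have pos: "0 < \<bar>y n\<bar>" using nonzero[of n] by simp
  have "1 < \<bar>y n\<bar> * (2 + small_golden)"
    using mult_strict_left_mono[OF assms(2) pos] step'[of n] by simp
  also have "\<dots> \<le> (1 - small_golden) * (2 + small_golden)"
    using le small_golden_bounds by (intro mult_right_mono) auto
  \<comment> \<open>g^2 and 2 + g are reciprocal. The bound 2 + g on \<open>d n + y (Suc n)\<close>
    covers digit 1 always, and digit 3 when the next point is below the threshold.\<close>
  also have "\<dots> = 1"
    using small_golden_sq by (simp add: algebra_simps)
  finally show False by simp
qed

text \<open>Here 1 + \<open>y (Suc n)\<close> = 1/|\<open>y n\<close>| is at least 1/G = g. So the
  stricter bound of the invariant region is never demanded right after a digit 1.\<close>

lemma digit_one_successor: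
  assumes "d n = 1"
  shows "small_golden - 1 \<le> y (Suc n)"
proof (rule ccontr)
  assume "\<not> small_golden - 1 \<le> y (Suc n)"
  then have lt: "1 + y (Suc n) < small_golden" by simp
  have pos: "0 < \<bar>y n\<bar>" using nonzero[of n] by simp
  have "1 < \<bar>y n\<bar> * small_golden"
    using mult_strict_left_mono[OF lt pos] step'[of n] assms by simp
  also have "\<dots> \<le> (1 + small_golden) * small_golden"
    using abs_y_le small_golden_bounds by (intro mult_right_mono) auto
  also have "\<dots> = 1"
    using small_golden_sq by (simp add: algebra_simps)
  finally show False by simp
qed

lemma digit_cases:
  obtains "d n = 1" | "d n = 3" | "5 \<le> d n"
proof -
  have "d n \<noteq> 2" "d n \<noteq> 4" using d_odd[of n] by auto
  then show ?thesis using d_pos[of n] that by linarith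
qed

section \<open>The invariant region\<close>

abbreviation B :: "nat \<Rightarrow> real" where "B \<equiv> cden e d"
abbreviation A :: "nat \<Rightarrow> real" where "A \<equiv> cnum e d"

definition region :: "nat \<Rightarrow> bool" where
  "region n \<longleftrightarrow> 0 \<le> B n \<and> 0 < B (Suc n) \<and> B n \<le> (1 + small_golden) * B (Suc n)
     \<and> (y n < small_golden - 1 \<longrightarrow> B n \<le> (1 - small_golden) * B (Suc n))"

text \<open>For these digits |\<open>y n\<close>| > 1/(2 + g) = g^2, so the stricter bound applies
  and keeps \<open>B (Suc n) - B n\<close> away from 0.\<close>

lemma region_digit_one_minus:
  assumes "region n" and "d n = 1" and "e n = -1"
  shows "B n \<le> (1 - small_golden) * B (Suc n)"
proof -
  have "y n < small_golden - 1"
    using y_below_threshold[of n] assms(2,3) y_upper[of "Suc n"] by simp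
  then show ?thesis using assms(1) by (simp add: region_def)
qed

lemma cden_step_ge:
  assumes "region n" and "of_int m \<le> real_of_int (d n)"
  shows "(of_int m - 1 - small_golden) * B (Suc n) \<le> B (Suc (Suc n))"
proof -
  have r: "0 \<le> B n" "0 < B (Suc n)" "B n \<le> (1 + small_golden) * B (Suc n)"
    using assms(1) by (auto simp: region_def)
  have "of_int m * B (Suc n) \<le> of_int (d n) * B (Suc n)"
    using assms(2) r(2) by (intro mult_right_mono) auto
  moreover have "- B n \<le> of_int (e n) * B n"
    using e_cases[of n] r(1) by auto
  ultimately show ?thesis using r(3) by (simp add: algebra_simps)
qed

lemma region_Suc:
  assumes "region n"
  shows "region (Suc n)"
proof -
  define g where "g = small_golden"
  define b c h where "b = B n" and "c = B (Suc n)" and "h = B (Suc (Suc n))"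
  have g: "g * g = 1 - g" "0.618 < g" "g < 0.619"
    using small_golden_sq small_golden_bounds by (auto simp: g_def)
  have r: "0 \<le> b" "0 < c" "b \<le> (1 + g) * c"
    using assms by (auto simp: region_def g_def b_def c_def)
  have h: "h = of_int (d n) * c + of_int (e n) * b"
    by (simp add: h_def b_def c_def)
  \<comment> \<open>The factors \<open>k\<close> and \<open>l\<close> are lower bounds for
    \<open>h / c\<close>; the region asks for at least 1/G = g, and for 1/g^2 = 2 + g below the
    threshold.\<close>
  have *: "region (Suc n)"
    if k: "k * c \<le> h" "1 \<le> (1 + g) * k" and
      t: "y (Suc n) < g - 1 \<Longrightarrow> l * c \<le> h \<and> 1 \<le> (1 - g) * l" for k l :: real
  proof -
    have "0 < (1 + g) * k" "0 < 1 + g" using k(2) g(2) by auto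
    then have "0 < k" by (rule zero_less_mult_pos)
    then have "0 < h" using less_le_trans[OF mult_pos_pos k(1)] r(2) by blast
    moreover have "c \<le> (1 + g) * h"
    proof -
      have "c \<le> ((1 + g) * k) * c" using mult_right_mono[OF k(2), of c] r(2) by simp
      also have "\<dots> \<le> (1 + g) * h"
        using mult_left_mono[OF k(1), of "1 + g"] g(2) by (simp add: mult.assoc)
      finally show ?thesis .
    qed
    moreover have "c \<le> (1 - g) * h" if "y (Suc n) < g - 1"
    proof -
      have l: "l * c \<le> h" "1 \<le> (1 - g) * l" using t[OF that] by auto
      have "c \<le> ((1 - g) * l) * c" using mult_right_mono[OF l(2), of c] r(2) by simp
      also have "\<dots> \<le> (1 - g) * h"
        using mult_left_mono[OF l(1), of "1 - g"] g(3) by (simp add: mult.assoc)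
      finally show ?thesis .
    qed
    ultimately show ?thesis
      using r(2) by (simp add: region_def g_def c_def h_def del: cden.simps)
  qed
  show ?thesis
  proof (cases rule: digit_cases[of n])
    case 1
    have "g * c \<le> h"
    proof (cases "e n = 1")
      case True
      have "g * c \<le> 1 * c" using g r by (intro mult_right_mono) auto
      moreover have "h = c + b" using 1 True h by simp
      ultimately show ?thesis using r by linarith
    next
      case False
      then have "e n = -1" using e_cases[of n] by auto
      then show ?thesis
        using region_digit_one_minus[OF assms 1] h 1 by (simp add: b_def c_def g_def algebra_simps)
    qed
    moreover have "1 \<le> (1 + g) * g" using g by (simp add: algebra_simps)
    ultimately show ?thesis
      using * digit_one_successor[OF 1] by (simp add: g_def)
  next
    case 2
    have "(2 - g) * c \<le> h"
      using cden_step_ge[OF assms, of 3] 2 by (simp add: c_def h_def g_def del: cden.simps)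
    moreover have "1 \<le> (1 + g) * (2 - g)" using g by (simp add: algebra_simps)
    moreover have "(2 + g) * c \<le> h \<and> 1 \<le> (1 - g) * (2 + g)" if "y (Suc n) < g - 1"
    proof
      show "1 \<le> (1 - g) * (2 + g)" using g by (simp add: algebra_simps)
      show "(2 + g) * c \<le> h"
      proof (cases "e n = 1")
        case True
        have "(2 + g) * c \<le> 3 * c" using g r by (intro mult_right_mono) auto
        moreover have "h = 3 * c + b" using 2 True h by simp
        ultimately show ?thesis using r by linarith
      next
        case False
        then have "e n = -1" using e_cases[of n] by auto
        \<comment> \<open>Here \<open>d n + y (Suc n)\<close> < 2 + g, so \<open>y n\<close> was
          below the threshold too, and 3 - g^2 = 2 + g reproduces the stricter bound.\<close>
        moreover from this have "y n < small_golden - 1"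
          using that 2 y_below_threshold[of n] by (simp add: g_def)
        then have "b \<le> (1 - g) * c"
          using assms by (simp add: region_def g_def b_def c_def)
        ultimately show ?thesis using h 2 by (simp add: algebra_simps)
      qed
    qed
    ultimately show ?thesis using * by blast
  next
    case 3
    have "(4 - g) * c \<le> h"
      using cden_step_ge[OF assms, of 5] 3 by (simp add: c_def h_def g_def del: cden.simps)
    moreover have "1 \<le> (1 + g) * (4 - g)" "1 \<le> (1 - g) * (4 - g)"
      using g by (simp_all add: algebra_simps)
    ultimately show ?thesis using * by blast
  qed
qed

lemma region: "region n"
proof (induction n)
  case 0
  then show ?case using small_golden_bounds by (simp add: region_def)
next
  case (Suc n)
  then show ?case by (rule region_Suc)
qed

lemma cden_pos: "0 < B (Suc n)"
  using region[of n] by (simp add: region_def)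

text \<open>A digit \<open>d n = 1\<close> need not increase the denominators in one step, but it does in two.\<close>

lemma cden_growth_cases:
  "5 / 4 * B (Suc n) \<le> B (Suc (Suc n)) \<or> 25 / 16 * B n \<le> B (Suc (Suc n))"
proof (cases "d n = 1")
  case True
  define g where "g = small_golden"
  have g: "g * g = 1 - g" "0.618 < g" "g < 0.619"
    using small_golden_sq small_golden_bounds by (auto simp: g_def)
  have r: "0 \<le> B n" "0 < B (Suc n)" "B n \<le> (1 + g) * B (Suc n)"
    using region[of n] by (auto simp: region_def g_def)
  \<comment> \<open>\<open>B (Suc n)\<close> is at least g \<open>B n\<close>, and at least (2 + g)
    \<open>B n\<close> if \<open>e n = -1\<close>; adding or subtracting \<open>B n\<close> leaves
    the factor G either way.\<close>
  have "(1 + g) * B n \<le> B (Suc (Suc n))"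
  proof (cases "e n = 1")
    case e: True
    have "g * B n \<le> g * ((1 + g) * B (Suc n))"
      using r(3) g by (intro mult_left_mono) auto
    also have "\<dots> = (g + g * g) * B (Suc n)"
      by (simp add: algebra_simps)
    also have "\<dots> = B (Suc n)"
      using g(1) by simp
    finally show ?thesis using True e by (simp add: algebra_simps)
  next
    case False
    then have e: "e n = -1" using e_cases[of n] by auto
    have "B n \<le> (1 - g) * B (Suc n)"
      using region_digit_one_minus[OF region True e] by (simp add: g_def)
    then have "(2 + g) * B n \<le> (2 + g) * ((1 - g) * B (Suc n))"
      using g by (intro mult_left_mono) auto
    also have "\<dots> = (2 - g - g * g) * B (Suc n)"
      by (simp add: algebra_simps)
    also have "\<dots> = B (Suc n)"
      using g(1) by simp
    finally show ?thesis using True e by (simp add: algebra_simps)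
  qed
  \<comment> \<open>25/16 = (5/4)^2 lies below G and 5/4 below 2 - g, so both alternatives yield the
    rate 5/4 per step.\<close>
  moreover have "25 / 16 * B n \<le> (1 + g) * B n"
    using g r by (intro mult_right_mono) auto
  ultimately show ?thesis by linarith
next
  case False
  then have "3 \<le> d n" by (cases rule: digit_cases[of n]) auto
  then have "(3 - 1 - small_golden) * B (Suc n) \<le> B (Suc (Suc n))"
    using cden_step_ge[OF region, of 3 n] by simp
  moreover have "5 / 4 * B (Suc n) \<le> (3 - 1 - small_golden) * B (Suc n)"
    using cden_pos[of n] small_golden_bounds by (intro mult_right_mono) auto
  ultimately show ?thesis by linarith
qed

text \<open>The factor 4/5 allows for the denominator \<open>B 2 = d 0\<close>, which may be
  1.\<close>

lemma cden_growth: "4 / 5 * (5 / 4) ^ n \<le> B (Suc n)"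
proof (induction n rule: less_induct)
  case (less n)
  consider "n = 0" | "n = 1" | m where "n = Suc (Suc m)"
    by (metis One_nat_def not0_implies_Suc)
  then show ?case
  proof cases
    case 1
    then show ?thesis by simp
  next
    case 2
    then show ?thesis using d_pos[of 0] by simp
  next
    case 3
    have "4 / 5 * (5 / 4) ^ Suc m \<le> B (Suc (Suc m))" "4 / 5 * (5 / 4) ^ m \<le> B (Suc m)"
      using less 3 by (blast intro: lessI less_SucI)+
    then show ?thesis
      using cden_growth_cases[of "Suc m"] 3 by (auto simp del: cden.simps)
  qed
qed

section \<open>The truncation error\<close>

text \<open>\<open>y 0\<close> is a Moebius image of \<open>y n\<close> given by the continuants.
  Passing from \<open>n\<close> to \<open>Suc n\<close> multiplies both sides by
  1/|\<open>y n\<close>|.\<close>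

lemma y_eq_continuants: "y 0 * (B (Suc n) + y n * B n) = A (Suc n) + y n * A n"
proof (induction n)
  case 0
  then show ?case by simp
next
  case (Suc n)
  define s where "s = of_int (d n) + y (Suc n)"
  have e: "of_int (e n) = s * y n"
    using step'[of n] e_cases[of n] by (auto simp: s_def algebra_simps)
  have "y 0 * (B (Suc (Suc n)) + y (Suc n) * B (Suc n))
      = s * (y 0 * (B (Suc n) + y n * B n))"
    by (simp add: e) (simp add: s_def algebra_simps)
  also have "\<dots> = A (Suc (Suc n)) + y (Suc n) * A (Suc n)"
    unfolding Suc by (simp add: e) (simp add: s_def algebra_simps)
  finally show ?case .
qed

text \<open>The loss through negative \<open>y n\<close> is at most a factor (2 - g) g^2 below the
  threshold and g^2 G = g otherwise, both under 2/3.\<close>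

lemma remainder_ge: "B (Suc n) / 3 \<le> B (Suc n) + y n * B n"
proof -
  define g where "g = small_golden"
  have g: "g * g = 1 - g" "0.618 < g" "g < 0.619"
    using small_golden_sq small_golden_bounds by (auto simp: g_def)
  have r: "0 \<le> B n" "0 < B (Suc n)" "B n \<le> (1 + g) * B (Suc n)"
    using region[of n] by (auto simp: region_def g_def)
  have "- (2 / 3) * B (Suc n) \<le> y n * B n"
  proof (cases "y n < g - 1")
    case True
    then have b: "B n \<le> (1 - g) * B (Suc n)"
      using region[of n] by (simp add: region_def g_def)
    have "(2 - g) * B n \<le> (2 - g) * ((1 - g) * B (Suc n))"
      using b g by (intro mult_left_mono) auto
    also have "\<dots> = (2 - 3 * g + g * g) * B (Suc n)"
      by (simp add: algebra_simps)
    also have "\<dots> \<le> 2 / 3 * B (Suc n)"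
      using g r by (intro mult_right_mono) auto
    finally have "- (2 / 3) * B (Suc n) \<le> (g - 2) * B n"
      by (simp add: algebra_simps)
    also have "\<dots> \<le> y n * B n"
      using y_lower[of n] r by (intro mult_right_mono) (auto simp: g_def)
    finally show ?thesis .
  next
    case False
    have "(1 - g) * B n \<le> (1 - g) * ((1 + g) * B (Suc n))"
      using r g by (intro mult_left_mono) auto
    also have "\<dots> = (1 - g * g) * B (Suc n)"
      by (simp add: algebra_simps)
    also have "\<dots> \<le> 2 / 3 * B (Suc n)"
      using g r by (intro mult_right_mono) auto
    finally have "- (2 / 3) * B (Suc n) \<le> (g - 1) * B n"
      by (simp add: algebra_simps)
    also have "\<dots> \<le> y n * B n"
      using False r by (intro mult_right_mono) auto
    finally show ?thesis .
  qed
  then show ?thesis by simp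
qed

text \<open>By \<open>y_eq_continuants\<close> and the determinant the error is |\<open>y n\<close>|
  / (\<open>b * r\<close>); here |\<open>y n\<close>| \<le> 2 and \<open>r\<close> is at least
  \<open>b / 3\<close>.\<close>

lemma truncation_error: "\<bar>A (Suc n) / B (Suc n) - y 0\<bar> \<le> 6 / (B (Suc n))\<^sup>2"
proof -
  define b r where "b = B (Suc n)" and "r = B (Suc n) + y n * B n"
  have b: "0 < b" using cden_pos by (simp add: b_def)
  have r: "b / 3 \<le> r" using remainder_ge by (simp add: b_def r_def)
  then have "0 < r" using b by linarith
  have "(A (Suc n) / b - y 0) * (b * r) = A (Suc n) * r - b * (y 0 * r)"
    using b by (simp add: field_simps)
  also have "\<dots> = - y n * (A n * B (Suc n) - A (Suc n) * B n)"
    unfolding r_def y_eq_continuants by (simp add: b_def algebra_simps)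
  finally have eq: "(A (Suc n) / b - y 0) * (b * r)
      = - y n * (A n * B (Suc n) - A (Suc n) * B n)" .
  have det: "\<bar>A n * B (Suc n) - A (Suc n) * B n\<bar> = 1"
    using e_cases by (intro continuant_det) blast
  have "\<bar>A (Suc n) / b - y 0\<bar> * (b * r) = \<bar>(A (Suc n) / b - y 0) * (b * r)\<bar>"
    using b \<open>0 < r\<close> by (simp only: abs_mult abs_of_pos)
  also have "\<dots> = \<bar>y n\<bar>"
    unfolding eq abs_mult det by simp
  also have "\<dots> \<le> 2"
    using abs_y_le[of n] small_golden_bounds by simp
  finally have "\<bar>A (Suc n) / b - y 0\<bar> \<le> 2 / (b * r)"
    using b \<open>0 < r\<close> by (simp add: field_simps)
  also have "\<dots> \<le> 2 / (b * (b / 3))"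
    using b r by (intro divide_left_mono mult_left_mono mult_pos_pos) auto
  also have "\<dots> = 6 / b\<^sup>2"
    by (simp add: power2_eq_square)
  finally show ?thesis by (simp add: b_def)
qed

lemma has_cf_value: "has_cf_value e d (y 0)"
proof -
  have "cden (\<lambda>i. e (i + k)) (\<lambda>i. d (i + k)) (Suc n) \<noteq> 0" for k n
    using odd_expansion.cden_pos[OF tail, of k n] by simp
  then have *: "cf_trunc_defined e d n" "cf_trunc e d n = A (Suc n) / B (Suc n)" for n
    using cf_trunc_eq_continuants[of e d n] by blast+
  have lim: "(\<lambda>n. 6 * (25 / 16) * (16 / 25) ^ n) \<longlonglongrightarrow> (0::real)"
    by (intro tendsto_mult_right_zero LIMSEQ_power_zero) simp
  have "\<bar>cf_trunc e d n - y 0\<bar> \<le> 6 * (25 / 16) * (16 / 25) ^ n" for n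
  proof -
    have "6 / (B (Suc n))\<^sup>2 \<le> 6 / (4 / 5 * (5 / 4) ^ n)\<^sup>2"
      using cden_growth[of n] cden_pos[of n]
      by (intro divide_left_mono power_mono mult_pos_pos zero_less_power) auto
    also have "\<dots> = 6 * (25 / 16) * (16 / 25) ^ n"
      by (simp add: power_mult_distrib power_divide power2_eq_square flip: power_mult_distrib)
    finally show ?thesis
      using truncation_error[of n] *(2)[of n] by linarith
  qed
  then have "(\<lambda>n. cf_trunc e d n - y 0) \<longlonglongrightarrow> 0"
    by (intro tendsto_rabs_zero_cancel[OF tendsto_sandwich[OF _ _ tendsto_const lim]]) auto
  then show ?thesis
    using *(1) unfolding has_cf_value_def LIM_zero_iff by blast
qed

end

subsection \<open>Uniqueness\<close>

text \<open>The product form passes to the limit without \<open>d 0 + y\<close> being known to be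
  nonzero.\<close>

lemma cf_value_step:
  assumes "has_cf_value e d x" and "has_cf_value (\<lambda>i. e (Suc i)) (\<lambda>i. d (Suc i)) y"
  shows "x * (of_int (d 0) + y) = of_int (e 0)"
proof -
  let ?t = "cf_trunc (\<lambda>i. e (Suc i)) (\<lambda>i. d (Suc i))"
  have "(\<lambda>n. cf_trunc e d (Suc n) * (of_int (d 0) + ?t n)) \<longlonglongrightarrow> x * (of_int (d 0) + y)"
    using assms unfolding has_cf_value_def
    by (intro tendsto_intros LIMSEQ_Suc) auto
  moreover have "cf_trunc e d (Suc n) * (of_int (d 0) + ?t n) = of_int (e 0)" for n
  proof -
    have "cf_trunc_defined e d (Suc n)"
      using assms(1) by (simp only: has_cf_value_def)
    then show ?thesis by simp
  qed
  ultimately show ?thesis by (simp add: LIMSEQ_const_iff)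
qed

text \<open>
  The digits are read off from \<open>x * (d + z) = e\<close> once \<open>d + z > 0\<close> is known. A negative \<open>d + z\<close>
  would require \<open>d = 1\<close> and \<open>z \<ge> \<alpha> - 2\<close> close to \<open>- 1\<close>, which makes \<open>\<bar>x\<bar>\<close> larger than \<open>G\<close>.
\<close>

lemma digits_determined:
  assumes \<alpha>: "\<alpha> \<in> {small_golden..big_golden}" and x: "x \<in> I_alpha \<alpha>" and z: "z \<in> I_alpha \<alpha>"
    and e: "e \<in> {1, -1}" and d: "odd d" "0 < d" and eq: "x * (of_int d + z) = of_int e"
  shows "of_int e = sgn x \<and> d = d_alpha \<alpha> x \<and> z = phi_alpha \<alpha> x"
proof -
  define s where "s = of_int d + z"
  have xs: "\<bar>x\<bar> * \<bar>s\<bar> = 1"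
    using eq e by (auto simp: s_def simp flip: abs_mult)
  then have nz: "x \<noteq> 0" "s \<noteq> 0" by auto
  have "0 < s"
  proof (rule ccontr)
    assume "\<not> 0 < s"
    \<comment> \<open>Since \<open>d\<close> \<ge> 1 and \<open>z\<close> \<ge> g - 2,
      \<open>s\<close> lies between -g^2 and 0; but then |\<open>x * s\<close>| \<le> G g^2 = g <
      1.\<close>
    then have "\<bar>s\<bar> \<le> 1 - small_golden"
      using d(2) z \<alpha> by (auto simp: s_def I_alpha_def)
    then have "\<bar>x\<bar> * \<bar>s\<bar> \<le> (1 + small_golden) * (1 - small_golden)"
      using abs_le_big_golden[OF \<alpha> x] small_golden_bounds
      by (intro mult_mono) (auto simp: big_golden_eq)
    also have "\<dots> < 1"
      using small_golden_sq small_golden_bounds by (simp add: algebra_simps)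
    finally show False using xs by simp
  qed
  then have "1 / \<bar>x\<bar> = of_int d + z"
    using xs nz by (simp add: s_def field_simps)
  moreover from this have "d_alpha \<alpha> x = d"
    using d_alpha_unique d(1) z by blast
  moreover have "of_int e = sgn x"
  proof -
    have "sgn x * sgn s = sgn (of_int e :: real)"
      using eq by (simp add: s_def flip: sgn_mult)
    then show ?thesis using \<open>0 < s\<close> e by auto
  qed
  ultimately show ?thesis using nz by (simp add: phi_alpha_def)
qed

text \<open>By \<open>digits_determined\<close> the values of the tails form an orbit of
  \<open>phi_alpha \<alpha>\<close>; uniqueness of limits makes \<open>x\<close> its first
  point.\<close>

lemma alpha_representation_digits:
  assumes \<alpha>: "\<alpha> \<in> {small_golden..big_golden}" and rep: "alpha_representation \<alpha> e d x"
  shows "of_int (e i) = sgn ((phi_alpha \<alpha> ^^ i) x) \<and> d i = d_alpha \<alpha> ((phi_alpha \<alpha> ^^ i) x)"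
proof -
  obtain y where y: "\<And>k. y k \<in> I_alpha \<alpha>"
      "\<And>k. has_cf_value (\<lambda>i. e (i + k)) (\<lambda>i. d (i + k)) (y k)"
    using rep unfolding alpha_representation_def by metis
  have dig: "e k \<in> {1, -1}" "odd (d k)" "0 < d k" for k
    using rep unfolding alpha_representation_def odd_cf_representation_def by blast+
  have "y k * (of_int (d k) + y (Suc k)) = of_int (e k)" for k
    using cf_value_step[OF y(2)[of k], of "y (Suc k)"] y(2)[of "Suc k"] by simp
  then have *: "of_int (e k) = sgn (y k) \<and> d k = d_alpha \<alpha> (y k) \<and> y (Suc k) = phi_alpha \<alpha> (y k)"
    for k
    using digits_determined[OF \<alpha> y(1) y(1) dig] by blast
  have "y 0 = x"
    using rep y(2)[of 0] LIMSEQ_unique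
    unfolding alpha_representation_def odd_cf_representation_def has_cf_value_def by auto
  then have "y k = (phi_alpha \<alpha> ^^ k) x" for k
    by (induction k) (simp_all add: *)
  then show ?thesis using * by metis
qed

section \<open>Existence and uniqueness of the expansion\<close>

theorem mainTheorem1:
  fixes \<alpha> x :: real
  assumes "\<alpha> \<in> {small_golden..big_golden}"
    and "x \<in> I_alpha \<alpha>"
    and "x \<notin> \<rat>"
  shows "\<exists>e d. alpha_representation \<alpha> e d x
           \<and> (\<forall>i. real_of_int (e i) = sgn ((phi_alpha \<alpha> ^^ i) x)
                  \<and> d i = d_alpha \<alpha> ((phi_alpha \<alpha> ^^ i) x))
           \<and> (\<forall>e' d'. alpha_representation \<alpha> e' d' x \<longrightarrow> e' = e \<and> d' = d)"
proof -
  define y where "y k = (phi_alpha \<alpha> ^^ k) x" for k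
  define e :: "nat \<Rightarrow> int" where "e k = (if 0 < y k then 1 else -1)" for k
  define d where "d k = d_alpha \<alpha> (y k)" for k
  have yI: "y k \<in> I_alpha \<alpha>" for k
    using phi_alpha_iterate_in_I_alpha assms(2,3) by (simp add: y_def)
  have nz: "y k \<noteq> 0" for k
    using phi_alpha_iterate_irrational[OF assms(3), of k \<alpha>] by (auto simp: y_def)
  have e: "real_of_int (e k) = sgn (y k)" for k
    using nz[of k] by (simp add: e_def)
  interpret odd_expansion \<alpha> y e d
  proof
    show "1 / \<bar>y n\<bar> = of_int (d n) + y (Suc n)" for n
    proof -
      have "y (Suc n) = phi_alpha \<alpha> (y n)" by (simp add: y_def)
      then show ?thesis using nz[of n] by (simp add: phi_alpha_def d_def)
    qed
    show "odd (d n)" for n by (simp add: d_def d_alpha_def)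
  qed (use assms(1) yI nz e d_alpha_pos in \<open>auto simp: d_def\<close>)
  have "has_cf_value (\<lambda>i. e (i + k)) (\<lambda>i. d (i + k)) (y k)" for k
    using odd_expansion.has_cf_value[OF tail, of k] by simp
  moreover from this[of 0] have "has_cf_value e d x"
    by (simp add: y_def)
  moreover have "\<forall>i. e i \<in> {1, -1} \<and> odd (d i) \<and> d i > 0"
    using e_cases d_odd d_pos by (auto simp: e_def)
  ultimately have "alpha_representation \<alpha> e d x"
    unfolding alpha_representation_def odd_cf_representation_def using yI by blast
  moreover have "e' = e \<and> d' = d" if "alpha_representation \<alpha> e' d' x" for e' d'
  proof -
    have "real_of_int (e' i) = real_of_int (e i) \<and> d' i = d i" for i
      using alpha_representation_digits[OF assms(1) that, of i] e[of i]
      by (simp add: d_def y_def)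
    then show ?thesis by (auto simp: fun_eq_iff)
  qed
  moreover have "real_of_int (e i) = sgn ((phi_alpha \<alpha> ^^ i) x)
      \<and> d i = d_alpha \<alpha> ((phi_alpha \<alpha> ^^ i) x)" for i
    using e[of i] by (simp add: d_def y_def)
  ultimately show ?thesis
    by (intro exI[of _ e] exI[of _ d] conjI allI impI) blast+
qed

end
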